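(* Suppose that $\lambda_1\ge\dots\ge\lambda_{\tilde d}$, $\lambda_d>0$ and $\lambda_d>\lambda_{d+1}$. Given a parameter $c\in(0,\lambda_d^{-1}\|b\|^2]$, let $\delta,\tau,\eta,\omega$ be the quantities defined in the context for this $c$, and assume that $\omega<1$. Then there exists an integer $n\in\{1,\dots,\ell\}$ such that the $n$th iteration of CG on $(\tilde A,\tilde b)$ is well defined. Moreover, the $n$th iterate $\tilde v_n$ and residual $\tilde r_n$ satisfy $$\|\tilde v_n\|\le\frac{1}{(1-\omega)\lambda_d}\|\tilde b\|\qquad\text{and}\qquad\|\tilde r_n\|^2\le\frac{1}{(1-\omega)^2}\Big(\lambda_1c+(1+\eta)(1+\delta)\omega\|B\|_{\mathrm F}^2+(1+\tau)^2\|B\|_{\mathrm F}^2\Big).$$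
   Context: Let $\tilde d\ge d$ be positive integers, $\lambda_1,\dots,\lambda_{\tilde d}\in\mathbb{R}$ and $b_1,\dots,b_{\tilde d}\in\mathbb{R}$. Let $A=\mathrm{diag}(\lambda_1,\dots,\lambda_d)$, $b=(b_1,\dots,b_d)^\top$, $\tilde A=\mathrm{diag}(\lambda_1,\dots,\lambda_{\tilde d})$, $\tilde b=(b_1,\dots,b_{\tilde d})^\top$, and $B=\mathrm{diag}(b_{d+1},\dots,b_{\tilde d})$. For a symmetric matrix $M$ and vector $y$, the $n$th Krylov space is $\mathcal{K}_n(M,y)=\mathrm{span}\{y,My,\dots,M^{n-1}y\}$ and the grade is the largest $n$ with $\dim\mathcal{K}_n(M,y)=n$. Let $\ell$ be the grade of $(A,b)$. The $n$th iteration of CG (conjugate gradients started at zero) on $(M,y)$ is well defined if $n$ is at most the grade of $(M,y)$ and $v^\top Mv>0$ for all nonzero $v\in\mathcal{K}_n(M,y)$; in that case the $n$th iterate $v_n$ is the unique minimizer of $\frac12v^\top Mv-y^\top v$ over $v\in\mathcal{K}_n(M,y)$ and the residual is $r_n=y-Mv_n$. $\mathcal{P}_{\le n}$ is the space of real univariate polynomials of degree at most $n$. On polynomials define $\langle p,q\rangle=\sum_{i=1}^d b_i^2p(\lambda_i)q(\lambda_i)$, with induced semi-norm $\|\cdot\|$ (for vectors, $\|\cdot\|$ is the Euclidean norm; $\|\cdot\|_{\mathrm F}$ is the Frobenius norm). For $n\le\ell$, $\pi_n$ is the unique minimizer of $\|\pi\|^2$ over $\pi\in\mathcal{P}_{\le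 n}$ whose coefficient of degree $n$ equals $1$. For $d<j\le\tilde d$ and $0\le n<\ell$, $\zeta_n^j$ is the unique minimizer of $\|\zeta\|^2$ over $\zeta\in\mathcal{P}_{\le n}$ subject to $\zeta(\lambda_j)=1$. Under the stated assumptions on the $\lambda_i$, all roots of $\pi_n$ and $\zeta_n^j$ are real and positive; define $\varsigma_n=\pi_n/\pi_n(0)$ and $\xi_n^j=\zeta_n^j/\zeta_n^j(0)$. Definition of $\delta,\tau,\eta,\omega$: under the stated assumptions, for each $c\in(0,\lambda_d^{-1}\|b\|^2]$ there is known to exist an iteration $m\in\{1,\dots,\ell\}$ with $\|\varsigma_m\|^2\le\lambda_1c$ and $\|\xi_{m-1}^j\|^2\ge\lambda_dc$ for all $j\in\{d+1,\dots,\tilde d\}$. The quantities are evaluated at such an iteration $m$: $$\delta=\max_{i,j\in\{d+1,\dots,\tilde d\}}|\xi_{m-1}^j(\lambda_i)-1|,\qquad\tau=\max_{i\in\{d+1,\dots,\tilde d\}}|\varsigma_m(\lambda_i)-1|,$$ $$\eta=\tau+(1+\tau)(1+\delta)^2(\lambda_dc)^{-1}\|B\|_{\mathrm F}^2,\qquad\omega=(1+\eta)(1+\delta)(\lambda_dc)^{-1}\|B\|_{\mathrm F}^2.$$ *)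

theory Defs
  imports
    Complex_Main
    "HOL-Computational_Algebra.Polynomial"
    "Jordan_Normal_Form.DL_Rank"
begin

definition vec_nrm :: "real vec \<Rightarrow> real" where
  "vec_nrm v = sqrt (v \<bullet> v)"

definition frob_nrm :: "real mat \<Rightarrow> real" where
  "frob_nrm M = sqrt (\<Sum>i<dim_row M. \<Sum>j<dim_col M. (M $$ (i, j))\<^sup>2)"

definition krylov :: "real mat \<Rightarrow> real vec \<Rightarrow> nat \<Rightarrow> real vec set" where
  "krylov M y n =
     LinearCombinations.module.span class_ring (module_vec TYPE(real) (dim_vec y))
       ((\<lambda>k. (M ^\<^sub>m k) *\<^sub>v y) ` {..<n})"

definition krylov_dim :: "real mat \<Rightarrow> real vec \<Rightarrow> nat \<Rightarrow> nat" where
  "krylov_dim M y n =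
     vectorspace.dim class_ring
       ((module_vec TYPE(real) (dim_vec y)) \<lparr>carrier := krylov M y n\<rparr>)"

text \<open>The maximum exists: any such \<open>n\<close> is at most the dimension of the ambient space,
  and 0 is one of them.\<close>

definition grade :: "real mat \<Rightarrow> real vec \<Rightarrow> nat" where
  "grade M y = (GREATEST n. krylov_dim M y n = n)"

definition cg_well_defined :: "real mat \<Rightarrow> real vec \<Rightarrow> nat \<Rightarrow> bool" where
  "cg_well_defined M y n \<longleftrightarrow>
     n \<le> grade M y \<and>
     (\<forall>v \<in> krylov M y n. v \<noteq> 0\<^sub>v (dim_vec y) \<longrightarrow> v \<bullet> (M *\<^sub>v v) > 0)"

definition cg_iterate :: "real mat \<Rightarrow> real vec \<Rightarrow> nat \<Rightarrow> real vec" where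
  "cg_iterate M y n =
     (THE v. is_arg_min (\<lambda>v. 1/2 * (v \<bullet> (M *\<^sub>v v)) - y \<bullet> v) (\<lambda>v. v \<in> krylov M y n) v)"

definition cg_residual :: "real mat \<Rightarrow> real vec \<Rightarrow> nat \<Rightarrow> real vec" where
  "cg_residual M y n = y - M *\<^sub>v cg_iterate M y n"

text \<open>The sequences \<open>lam\<close> and \<open>b\<close> are indexed from 1 on, whereas the entries of vectors and
  matrices are indexed from 0 on.  With a size \<open>dt\<close> in place of \<open>d\<close>, the first two definitions
  give the extended problem.\<close>

definition A_mat :: "nat \<Rightarrow> (nat \<Rightarrow> real) \<Rightarrow> real mat" where
  "A_mat d lam = mat_diag d (\<lambda>i. lam (i + 1))"

definition b_vec :: "nat \<Rightarrow> (nat \<Rightarrow> real) \<Rightarrow> real vec" where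
  "b_vec d b = vec d (\<lambda>i. b (i + 1))"

definition B_mat :: "nat \<Rightarrow> nat \<Rightarrow> (nat \<Rightarrow> real) \<Rightarrow> real mat" where
  "B_mat d dt b = mat_diag (dt - d) (\<lambda>i. b (d + i + 1))"

definition poly_inner ::
    "nat \<Rightarrow> (nat \<Rightarrow> real) \<Rightarrow> (nat \<Rightarrow> real) \<Rightarrow> real poly \<Rightarrow> real poly \<Rightarrow> real" where
  "poly_inner d lam b p q = (\<Sum>i = 1..d. (b i)\<^sup>2 * poly p (lam i) * poly q (lam i))"

definition poly_nrm :: "nat \<Rightarrow> (nat \<Rightarrow> real) \<Rightarrow> (nat \<Rightarrow> real) \<Rightarrow> real poly \<Rightarrow> real" where
  "poly_nrm d lam b p = sqrt (poly_inner d lam b p p)"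

definition pi_poly :: "nat \<Rightarrow> (nat \<Rightarrow> real) \<Rightarrow> (nat \<Rightarrow> real) \<Rightarrow> nat \<Rightarrow> real poly" where
  "pi_poly d lam b n =
     (THE p. is_arg_min (\<lambda>p. (poly_nrm d lam b p)\<^sup>2) (\<lambda>p. degree p \<le> n \<and> coeff p n = 1) p)"

definition zeta_poly ::
    "nat \<Rightarrow> (nat \<Rightarrow> real) \<Rightarrow> (nat \<Rightarrow> real) \<Rightarrow> nat \<Rightarrow> nat \<Rightarrow> real poly" where
  "zeta_poly d lam b j n =
     (THE p. is_arg_min (\<lambda>p. (poly_nrm d lam b p)\<^sup>2) (\<lambda>p. degree p \<le> n \<and> poly p (lam j) = 1) p)"

definition varsigma_poly :: "nat \<Rightarrow> (nat \<Rightarrow> real) \<Rightarrow> (nat \<Rightarrow> real) \<Rightarrow> nat \<Rightarrow> real poly" where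
  "varsigma_poly d lam b n = Polynomial.smult (1 / poly (pi_poly d lam b n) 0) (pi_poly d lam b n)"

definition xi_poly ::
    "nat \<Rightarrow> (nat \<Rightarrow> real) \<Rightarrow> (nat \<Rightarrow> real) \<Rightarrow> nat \<Rightarrow> nat \<Rightarrow> real poly" where
  "xi_poly d lam b j n = Polynomial.smult (1 / poly (zeta_poly d lam b j n) 0) (zeta_poly d lam b j n)"

definition admissible_iteration ::
    "nat \<Rightarrow> nat \<Rightarrow> (nat \<Rightarrow> real) \<Rightarrow> (nat \<Rightarrow> real) \<Rightarrow> real \<Rightarrow> nat \<Rightarrow> bool" where
  "admissible_iteration d dt lam b c m \<longleftrightarrow>
     m \<in> {1..grade (A_mat d lam) (b_vec d b)} \<and>
     (poly_nrm d lam b (varsigma_poly d lam b m))\<^sup>2 \<le> lam 1 * c \<and>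
     (\<forall>j \<in> {d+1..dt}. (poly_nrm d lam b (xi_poly d lam b j (m - 1)))\<^sup>2 \<ge> lam d * c)"

text \<open>For \<open>dt = d\<close> the index set \<open>{d+1..dt}\<close> is empty; inserting 0 makes both maxima 0 in that
  case and has no effect otherwise, as the absolute values are nonnegative.\<close>

definition delta ::
    "nat \<Rightarrow> nat \<Rightarrow> (nat \<Rightarrow> real) \<Rightarrow> (nat \<Rightarrow> real) \<Rightarrow> nat \<Rightarrow> real" where
  "delta d dt lam b m =
     Max (insert 0 ((\<lambda>(i, j). \<bar>poly (xi_poly d lam b j (m - 1)) (lam i) - 1\<bar>)
                      ` ({d+1..dt} \<times> {d+1..dt})))"

definition tau ::
    "nat \<Rightarrow> nat \<Rightarrow> (nat \<Rightarrow> real) \<Rightarrow> (nat \<Rightarrow> real) \<Rightarrow> nat \<Rightarrow> real" where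
  "tau d dt lam b m =
     Max (insert 0 ((\<lambda>i. \<bar>poly (varsigma_poly d lam b m) (lam i) - 1\<bar>) ` {d+1..dt}))"

definition eta ::
    "nat \<Rightarrow> nat \<Rightarrow> (nat \<Rightarrow> real) \<Rightarrow> (nat \<Rightarrow> real) \<Rightarrow> real \<Rightarrow> nat \<Rightarrow> real" where
  "eta d dt lam b c m =
     tau d dt lam b m
     + (1 + tau d dt lam b m) * (1 + delta d dt lam b m)\<^sup>2
       * inverse (lam d * c) * (frob_nrm (B_mat d dt b))\<^sup>2"

definition omega ::
    "nat \<Rightarrow> nat \<Rightarrow> (nat \<Rightarrow> real) \<Rightarrow> (nat \<Rightarrow> real) \<Rightarrow> real \<Rightarrow> nat \<Rightarrow> real" where
  "omega d dt lam b c m =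
     (1 + eta d dt lam b c m) * (1 + delta d dt lam b m)
     * inverse (lam d * c) * (frob_nrm (B_mat d dt b))\<^sup>2"

end

theory Submission
  imports Defs "HOL-Analysis.L2_Norm"
begin

text \<open>
  The iteration \<open>n = m\<close> works.  A vector \<open>p(A)b\<close> is identified with the polynomial \<open>p\<close>, so that
  Krylov spaces become spaces of polynomials of degree below \<open>n\<close> and the CG residual becomes the
  polynomial \<open>r\<close> with \<open>r(0) = 1\<close> orthogonal to them.  Let \<open>k\<^sub>j\<close> represent the evaluation at
  \<open>\<lambda>\<^sub>j\<close>, \<open>j > d\<close>; it is a multiple of \<open>\<xi>\<^sup>j\<close>, which gives \<open>|k\<^sub>j(0)| \<le> (1 + \<delta>) / (\<lambda>\<^sub>d c)\<close>.

  For the coercivity of the extended matrix on the Krylov space, note that \<open>(k\<^sub>j - k\<^sub>j(0) \<varsigma>\<^sub>m) / x\<close>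
  represents the evaluation at \<open>\<lambda>\<^sub>j\<close> with respect to \<open>\<langle>xp, q\<rangle>\<close>.  This bounds
  \<open>(\<mu> - \<lambda>\<^sub>j) p(\<lambda>\<^sub>j)\<^sup>2\<close> by \<open>|k\<^sub>j(0) \<varsigma>\<^sub>m(\<lambda>\<^sub>j)| \<langle>xp, p\<rangle>\<close> for \<open>\<mu> \<le> \<lambda>\<^sub>d\<close>, and summing over \<open>j\<close> shows
  that all Ritz values are at least \<open>(1 - \<omega>) \<lambda>\<^sub>d\<close>.

  For the residual, the polynomial \<open>\<rho> = \<varsigma>\<^sub>m - g\<close> orthogonal in the extended inner product has
  \<open>g = \<Sum>\<^sub>j b\<^sub>j\<^sup>2 \<rho>(\<lambda>\<^sub>j) k\<^sub>j\<close>.  Positivity of the kernel gives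
  \<open>\<Sum>\<^sub>j b\<^sub>j\<^sup>2 \<rho>(\<lambda>\<^sub>j)\<^sup>2 \<le> \<Sum>\<^sub>j b\<^sub>j\<^sup>2 \<varsigma>\<^sub>m(\<lambda>\<^sub>j)\<^sup>2\<close>, from which \<open>|\<rho>(\<lambda>\<^sub>j)| \<le> 1 + \<eta>\<close> and
  \<open>|g(0)| \<le> \<omega>\<close> follow.  The residual polynomial is \<open>\<rho> / \<rho>(0)\<close>.
\<close>

section \<open>Krylov spaces of diagonal matrices\<close>

text \<open>Phrased by coefficients so that \<open>n = 0\<close> leaves exactly the zero polynomial,
  where \<open>degree p < n\<close> would leave nothing.\<close>

definition polys_below :: "nat \<Rightarrow> real poly set" where
  "polys_below n = {p. \<forall>i\<ge>n. coeff p i = 0}"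

text \<open>The vector \<open>p(A) b\<close> for the diagonal matrix \<open>A\<close>.\<close>

definition nodal_vec :: "nat \<Rightarrow> (nat \<Rightarrow> real) \<Rightarrow> (nat \<Rightarrow> real) \<Rightarrow> real poly \<Rightarrow> real vec" where
  "nodal_vec d lam b p = vec d (\<lambda>i. b (i + 1) * poly p (lam (i + 1)))"

text \<open>A Vandermonde matrix with rows scaled by \<open>b\<close>; its columns are the Krylov
  vectors \<open>A^k b\<close>.\<close>

definition krylov_mat :: "nat \<Rightarrow> (nat \<Rightarrow> real) \<Rightarrow> (nat \<Rightarrow> real) \<Rightarrow> nat \<Rightarrow> real mat" where
  "krylov_mat d lam b n = mat d n (\<lambda>(i, k). b (i + 1) * lam (i + 1) ^ k)"

lemma nodal_vec_dim [simp]: "dim_vec (nodal_vec d lam b p) = d"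
  and nodal_vec_carrier [simp]: "nodal_vec d lam b p \<in> carrier_vec d"
  by (simp_all add: nodal_vec_def)

lemma mat_diag_mult_vec_index:
  assumes "i < d" "v \<in> carrier_vec d"
  shows "(mat_diag d f *\<^sub>v v) $ i = f i * v $ i"
proof -
  have "(mat_diag d f *\<^sub>v v) $ i = (\<Sum>k = 0..<d. (if i = k then f k else 0) * v $ k)"
    using assms by (auto simp: mat_diag_def mult_mat_vec_def scalar_prod_def)
  also have "\<dots> = (\<Sum>k = 0..<d. if i = k then f k * v $ k else 0)"
    by (intro sum.cong) auto
  finally show ?thesis using assms by simp
qed

text \<open>On nodal vectors the matrix acts as multiplication by the variable, which is
  \<open>pCons 0\<close> throughout.\<close>

lemma A_mat_mult_nodal_vec:
  "A_mat d lam *\<^sub>v nodal_vec d lam b p = nodal_vec d lam b (pCons 0 p)"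
proof (rule eq_vecI)
  show "dim_vec (A_mat d lam *\<^sub>v nodal_vec d lam b p) = dim_vec (nodal_vec d lam b (pCons 0 p))"
    by (simp add: A_mat_def mat_diag_def)
  fix i assume "i < dim_vec (nodal_vec d lam b (pCons 0 p))"
  then have "i < d" by simp
  then show "(A_mat d lam *\<^sub>v nodal_vec d lam b p) $ i = nodal_vec d lam b (pCons 0 p) $ i"
    by (simp add: A_mat_def mat_diag_mult_vec_index) (simp add: nodal_vec_def)
qed

lemma b_vec_dim: "dim_vec (b_vec d b) = d"
  by (simp add: b_vec_def)

lemma b_vec_eq_nodal_vec: "b_vec d b = nodal_vec d lam b 1"
  by (simp add: b_vec_def nodal_vec_def)

lemma A_mat_pow_mult_b_vec:
  "(A_mat d lam ^\<^sub>m k) *\<^sub>v b_vec d b = nodal_vec d lam b (monom 1 k)"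
proof -
  have A: "A_mat d lam \<in> carrier_mat d d" by (simp add: A_mat_def)
  \<comment> \<open>The power \<open>Suc k\<close> applies the matrix first and then its power
    \<open>k\<close>, so the induction runs over an arbitrary polynomial \<open>q\<close>.\<close>
  have "(A_mat d lam ^\<^sub>m k) *\<^sub>v nodal_vec d lam b q = nodal_vec d lam b (monom 1 k * q)" for q
  proof (induction k arbitrary: q)
    case 0
    then show ?case using A by simp
  next
    case (Suc k)
    have "(A_mat d lam ^\<^sub>m Suc k) *\<^sub>v nodal_vec d lam b q
        = (A_mat d lam ^\<^sub>m k) *\<^sub>v (A_mat d lam *\<^sub>v nodal_vec d lam b q)"
      using A by (simp add: assoc_mult_mat_vec[of _ d d _ d])
    then show ?case by (simp add: A_mat_mult_nodal_vec Suc monom_Suc)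
  qed
  from this[of 1] show ?thesis by (simp add: b_vec_eq_nodal_vec[of d b lam])
qed

lemma cols_krylov_mat:
  "set (cols (krylov_mat d lam b n)) = (\<lambda>k. nodal_vec d lam b (monom 1 k)) ` {..<n}"
  by (auto simp: cols_def krylov_mat_def nodal_vec_def poly_monom image_iff atLeast0LessThan
      intro!: eq_vecI)

lemma krylov_mat_carrier [simp]: "krylov_mat d lam b n \<in> carrier_mat d n"
  by (simp add: krylov_mat_def)

lemma poly_eq_sum_below:
  fixes p :: "real poly"
  assumes "p \<in> polys_below n"
  shows "poly p x = (\<Sum>k<n. coeff p k * x ^ k)"
proof (cases "p = 0")
  case False
  have "degree p < n" using assms False by (metis (mono_tags, lifting) leading_coeff_0_iff
      mem_Collect_eq not_le polys_below_def)
  then show ?thesis using assms unfolding poly_altdef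
    by (intro sum.mono_neutral_left) (auto simp: coeff_eq_0)
qed simp

lemma krylov_mat_mult_coeffs:
  assumes "p \<in> polys_below n"
  shows "krylov_mat d lam b n *\<^sub>v vec n (coeff p) = nodal_vec d lam b p"
  by (rule eq_vecI)
    (auto simp: krylov_mat_def nodal_vec_def poly_eq_sum_below[OF assms] scalar_prod_def
      atLeast0LessThan sum_distrib_left mult_ac)

lemma ex_poly_coeffs:
  assumes "v \<in> carrier_vec n"
  obtains p where "p \<in> polys_below n" "v = vec n (coeff p)"
proof
  let ?p = "Poly (list_of_vec v)"
  show "?p \<in> polys_below n" using assms
    by (auto simp: polys_below_def coeff_Poly_eq nth_default_def)
  show "v = vec n (coeff ?p)" using assms
    by (intro eq_vecI) (auto simp: coeff_Poly_eq nth_default_def list_of_vec_index)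
qed

text \<open>The span of the columns of \<open>krylov_mat\<close> is its range, and a coefficient
  vector is mapped to the nodal vector of its polynomial.\<close>

lemma krylov_eq:
  "krylov (A_mat d lam) (b_vec d b) n = nodal_vec d lam b ` polys_below n"
proof -
  interpret vec_space "TYPE(real)" d .
  let ?V = "krylov_mat d lam b n"
  have "krylov (A_mat d lam) (b_vec d b) n = span (set (cols ?V))"
    by (simp add: krylov_def A_mat_pow_mult_b_vec cols_krylov_mat b_vec_dim)
  also have "\<dots> = span_list (cols ?V)"
    by (rule span_list_as_span[symmetric]) (auto simp: cols_krylov_mat)
  also have "\<dots> = {?V *\<^sub>v vec n c | c. True}"
  proof -
    have "lincomb_list c (cols ?V) = ?V *\<^sub>v vec n c" for c
      using lincomb_list_as_mat_mult[of "cols ?V" c]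
      by (simp add: cols_krylov_mat mat_of_cols_cols[of ?V])
        (metis cols_length krylov_mat_carrier carrier_matD mat_of_cols_cols)
    then show ?thesis by (auto simp: span_list_def)
  qed
  also have "\<dots> = nodal_vec d lam b ` polys_below n"
  proof safe
    fix c
    obtain p where "p \<in> polys_below n" "vec n c = vec n (coeff p)"
      by (rule ex_poly_coeffs[of "vec n c" n]) auto
    then show "?V *\<^sub>v vec n c \<in> nodal_vec d lam b ` polys_below n"
      by (simp add: krylov_mat_mult_coeffs)
  next
    fix p assume "p \<in> polys_below n"
    then show "\<exists>c. nodal_vec d lam b p = ?V *\<^sub>v vec n c \<and> True"
      using krylov_mat_mult_coeffs by metis
  qed
  finally show ?thesis .
qed

section \<open>The grade as injectivity of the map from polynomials to nodal vectors\<close>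

definition nodal_inj :: "nat \<Rightarrow> (nat \<Rightarrow> real) \<Rightarrow> (nat \<Rightarrow> real) \<Rightarrow> nat \<Rightarrow> bool" where
  "nodal_inj d lam b n \<longleftrightarrow> (\<forall>p \<in> polys_below n. nodal_vec d lam b p = 0\<^sub>v d \<longrightarrow> p = 0)"

lemma krylov_dim_eq_rank:
  "krylov_dim (A_mat d lam) (b_vec d b) n = vec_space.rank d (krylov_mat d lam b n)"
  by (simp add: krylov_dim_def krylov_def A_mat_pow_mult_b_vec vec_space.rank_def cols_krylov_mat
      b_vec_dim)

text \<open>Both sides say that the columns of \<open>krylov_mat\<close> are independent: a vector
  in its kernel is the coefficient list of a polynomial with vanishing nodal vector. The bound by
  \<open>d\<close> ensures that the maximum in \<open>grade\<close> exists.\<close>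

lemma krylov_dim_eq_iff:
  "krylov_dim (A_mat d lam) (b_vec d b) n = n \<longleftrightarrow> nodal_inj d lam b n" (is ?eq)
  and krylov_dim_eq_le: "krylov_dim (A_mat d lam) (b_vec d b) n = n \<Longrightarrow> n \<le> d"
proof -
  interpret vec_space "TYPE(real)" d .
  let ?V = "krylov_mat d lam b n"
  have V: "?V \<in> carrier_mat d n" by simp
  have fin: "finite (set (cols ?V))" by simp
  have len: "length (cols ?V) = n" by (simp add: krylov_mat_def)
  have sub: "set (cols ?V) \<subseteq> carrier_vec d" by (auto simp: cols_krylov_mat)
  \<comment> \<open>The rank is taken of the set of columns, where repeated columns collapse; rank
    \<open>n\<close> therefore forces \<open>n\<close> distinct ones.\<close>
  have full: "distinct (cols ?V) \<and> lin_indpt (set (cols ?V))" if r: "rank ?V = n"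
  proof -
    obtain S where S: "maximal S (\<lambda>T. T \<subseteq> set (cols ?V) \<and> lin_indpt T)"
      using maximal_exists[of "(\<lambda>T. T \<subseteq> set (cols ?V) \<and> lin_indpt T)" "card (set (cols ?V))" "{}"]
      by (meson List.finite_set card_mono empty_iff empty_subsetI finite_lin_indpt2 rev_finite_subset)
    then have "card S = n" "S \<subseteq> set (cols ?V)"
      using rank_card_indpt[OF V S] r by (auto simp: maximal_def)
    then have "n \<le> card (set (cols ?V))" by (metis card_mono fin)
    then have "distinct (cols ?V)" using len card_length[of "cols ?V"] by (metis card_distinct le_antisym)
    then show ?thesis using full_rank_lin_indpt[OF V r] by blast
  qed
  show ?eq
  proof
    assume "krylov_dim (A_mat d lam) (b_vec d b) n = n"
    then have di: "distinct (cols ?V)" "lin_indpt (set (cols ?V))"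
      using full by (auto simp: krylov_dim_eq_rank)
    show "nodal_inj d lam b n" unfolding nodal_inj_def
    proof safe
      fix p assume p: "p \<in> polys_below n" "nodal_vec d lam b p = 0\<^sub>v d"
      have "vec n (coeff p) = 0\<^sub>v n"
        using lin_depI[OF V, of "vec n (coeff p)"] di p krylov_mat_mult_coeffs[OF p(1)] by auto
      then have "coeff p k = 0" if "k < n" for k using that by (metis index_vec index_zero_vec(1))
      then show "p = 0" using p(1) by (intro poly_eqI) (metis (mono_tags) coeff_0 mem_Collect_eq not_le polys_below_def)
    qed
  next
    assume inj: "nodal_inj d lam b n"
    have di: "distinct (cols ?V)"
    proof -
      have "j = k" if "j < n" "k < n" "col ?V j = col ?V k" for j k
      proof -
        have "monom 1 j - monom 1 k \<in> polys_below n"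
          using that by (auto simp: polys_below_def)
        moreover have "nodal_vec d lam b (monom 1 j - monom 1 k) = 0\<^sub>v d"
        proof (rule eq_vecI)
          fix i assume "i < dim_vec (0\<^sub>v d)"
          then show "nodal_vec d lam b (monom 1 j - monom 1 k) $ i = 0\<^sub>v d $ i"
            using arg_cong[OF that(3), of "\<lambda>v. v $ i"] that
            by (simp add: krylov_mat_def nodal_vec_def poly_monom right_diff_distrib)
        qed simp
        ultimately have "monom 1 j = (monom 1 k :: real poly)" using inj by (auto simp: nodal_inj_def)
        then show ?thesis by (metis degree_monom_eq one_neq_zero)
      qed
      then show ?thesis using len by (auto simp: distinct_conv_nth cols_nth)
    qed
    have "lin_indpt (set (cols ?V))"
    proof (rule ccontr)
      assume "\<not> lin_indpt (set (cols ?V))"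
      then obtain v where v: "v \<in> carrier_vec n" "v \<noteq> 0\<^sub>v n" "?V *\<^sub>v v = 0\<^sub>v d"
        using lin_depE[OF V _ di] by blast
      obtain p where p: "p \<in> polys_below n" "v = vec n (coeff p)" using v(1) by (rule ex_poly_coeffs)
      then have "p = 0" using inj v krylov_mat_mult_coeffs[OF p(1)] by (auto simp: nodal_inj_def)
      then show False using v p by (auto simp: vec_eq_iff)
    qed
    then show "krylov_dim (A_mat d lam) (b_vec d b) n = n"
      using lin_indpt_full_rank[OF V di] by (simp add: krylov_dim_eq_rank)
  qed
  assume "krylov_dim (A_mat d lam) (b_vec d b) n = n"
  then have "distinct (cols ?V)" "lin_indpt (set (cols ?V))"
    using full by (auto simp: krylov_dim_eq_rank)
  then show "n \<le> d"
    using li_le_dim(2)[OF fin_dim sub] len dim_is_n by (simp add: distinct_card)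
qed

lemma nodal_inj_mono: "nodal_inj d lam b n \<Longrightarrow> k \<le> n \<Longrightarrow> nodal_inj d lam b k"
  by (auto simp: nodal_inj_def polys_below_def)

text \<open>The condition that the dimension equals \<open>n\<close> is inherited by smaller
  \<open>n\<close> and fails beyond \<open>d\<close>, so it holds exactly up to its greatest
  solution.\<close>

lemma le_grade_iff: "n \<le> grade (A_mat d lam) (b_vec d b) \<longleftrightarrow> nodal_inj d lam b n"
proof
  let ?P = "\<lambda>n. krylov_dim (A_mat d lam) (b_vec d b) n = n"
  have "?P 0" by (subst krylov_dim_eq_iff) (auto simp: nodal_inj_def polys_below_def poly_eq_iff)
  then have "?P (grade (A_mat d lam) (b_vec d b))"
    unfolding grade_def by (rule GreatestI_nat) (rule krylov_dim_eq_le)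
  then show "n \<le> grade (A_mat d lam) (b_vec d b) \<Longrightarrow> nodal_inj d lam b n"
    using krylov_dim_eq_iff nodal_inj_mono by blast
  assume "nodal_inj d lam b n"
  then show "n \<le> grade (A_mat d lam) (b_vec d b)"
    unfolding grade_def by (intro Greatest_le_nat) (use krylov_dim_eq_iff krylov_dim_eq_le in blast)+
qed


lemma nodal_vec_scalar_prod:
  "nodal_vec d lam b p \<bullet> nodal_vec d lam b q = poly_inner d lam b p q"
  unfolding scalar_prod_def poly_inner_def
  by (rule sum.reindex_bij_witness[of _ "\<lambda>i. i - 1" Suc])
    (auto simp: nodal_vec_def power2_eq_square mult_ac)

section \<open>Best approximation in the polynomial semi-inner product\<close>

lemma poly_inner_commute: "poly_inner d lam b p q = poly_inner d lam b q p"
  by (simp add: poly_inner_def mult_ac)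

lemma poly_inner_add_left:
  "poly_inner d lam b (p + q) r = poly_inner d lam b p r + poly_inner d lam b q r"
  by (simp add: poly_inner_def algebra_simps sum.distrib)

lemma poly_inner_diff_left:
  "poly_inner d lam b (p - q) r = poly_inner d lam b p r - poly_inner d lam b q r"
  by (simp add: poly_inner_def algebra_simps sum_subtractf)

lemma poly_inner_smult_left:
  "poly_inner d lam b (Polynomial.smult a p) r = a * poly_inner d lam b p r"
  by (simp add: poly_inner_def sum_distrib_left mult_ac)

lemma poly_inner_zero_left [simp]: "poly_inner d lam b 0 r = 0"
  by (simp add: poly_inner_def)

lemma poly_inner_sum_left:
  "poly_inner d lam b (sum f J) r = (\<Sum>j\<in>J. poly_inner d lam b (f j) r)"
  by (induction J rule: infinite_finite_induct) (auto simp: poly_inner_add_left)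

lemmas poly_inner_left =
  poly_inner_add_left poly_inner_diff_left poly_inner_smult_left poly_inner_zero_left

lemma poly_inner_right:
  "poly_inner d lam b r (p + q) = poly_inner d lam b r p + poly_inner d lam b r q"
  "poly_inner d lam b r (p - q) = poly_inner d lam b r p - poly_inner d lam b r q"
  "poly_inner d lam b r (Polynomial.smult a p) = a * poly_inner d lam b r p"
  "poly_inner d lam b r 0 = 0"
  by (simp_all add: poly_inner_left poly_inner_commute[of d lam b r])

lemma poly_inner_smult_self:
  "poly_inner d lam b (Polynomial.smult a p) (Polynomial.smult a p) = a\<^sup>2 * poly_inner d lam b p p"
  by (simp add: poly_inner_left poly_inner_right power2_eq_square)

lemma poly_inner_self_nonneg: "0 \<le> poly_inner d lam b p p"
  by (auto simp: poly_inner_def mult.assoc intro!: sum_nonneg)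

lemma poly_inner_pCons:
  "poly_inner d lam b (pCons 0 p) q = poly_inner d lam b p (pCons 0 q)"
  by (simp add: poly_inner_def mult_ac)

lemma poly_nrm_power2: "(poly_nrm d lam b p)\<^sup>2 = poly_inner d lam b p p"
  by (simp add: poly_nrm_def poly_inner_self_nonneg)

lemma poly_inner_Cauchy_Schwarz:
  "(poly_inner d lam b p q)\<^sup>2 \<le> poly_inner d lam b p p * poly_inner d lam b q q"
proof -
  let ?f = "\<lambda>p i. b i * poly p (lam i)"
  have eq: "poly_inner d lam b p q = (\<Sum>i = 1..d. ?f p i * ?f q i)" for p q
    by (simp add: poly_inner_def power2_eq_square mult_ac)
  have "\<bar>poly_inner d lam b p q\<bar> \<le> (\<Sum>i = 1..d. \<bar>?f p i\<bar> * \<bar>?f q i\<bar>)"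
    unfolding eq abs_mult[symmetric] by (rule sum_abs)
  also have "\<dots> \<le> L2_set (?f p) {1..d} * L2_set (?f q) {1..d}" by (rule L2_set_mult_ineq)
  finally have "(poly_inner d lam b p q)\<^sup>2 \<le> (L2_set (?f p) {1..d} * L2_set (?f q) {1..d})\<^sup>2"
    by (rule abs_le_square_iff[THEN iffD1, OF order_trans]) simp
  then show ?thesis
    by (simp add: power_mult_distrib L2_set_def sum_nonneg eq power2_eq_square[symmetric])
qed

lemma polys_below_add: "p \<in> polys_below n \<Longrightarrow> q \<in> polys_below n \<Longrightarrow> p + q \<in> polys_below n"
  and polys_below_diff: "p \<in> polys_below n \<Longrightarrow> q \<in> polys_below n \<Longrightarrow> p - q \<in> polys_below n"
  and polys_below_smult: "p \<in> polys_below n \<Longrightarrow> Polynomial.smult a p \<in> polys_below n"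
  and polys_below_mono: "p \<in> polys_below n \<Longrightarrow> n \<le> k \<Longrightarrow> p \<in> polys_below k"
  by (auto simp: polys_below_def)

lemma polys_below_SucD: "p \<in> polys_below (Suc n) \<Longrightarrow> coeff p n = 0 \<Longrightarrow> p \<in> polys_below n"
  unfolding polys_below_def mem_Collect_eq by (metis Suc_leI le_neq_implies_less)

lemma polys_below_sum: "(\<And>j. j \<in> J \<Longrightarrow> f j \<in> polys_below n) \<Longrightarrow> sum f J \<in> polys_below n"
  by (auto simp: polys_below_def coeff_sum)

lemma pCons_in_polys_below_Suc [simp]: "pCons a p \<in> polys_below (Suc n) \<longleftrightarrow> p \<in> polys_below n"
  by (auto simp: polys_below_def coeff_pCons split: nat.splits)

lemma degree_le_iff_polys_below: "degree p \<le> n \<longleftrightarrow> p \<in> polys_below (Suc n)"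
  by (auto simp: polys_below_def Suc_le_eq coeff_eq_0 intro: degree_le)

lemma one_in_polys_below: "1 \<le> n \<Longrightarrow> 1 \<in> polys_below n"
  by (auto simp: polys_below_def)

text \<open>The semi-norm is the Euclidean norm of the nodal vector, hence definite up to the
  grade.\<close>

lemma nodal_injD:
  assumes "nodal_inj d lam b n" "p \<in> polys_below n" "poly_inner d lam b p p \<le> 0"
  shows "p = 0"
proof -
  have "(\<Sum>i = 0..<d. (nodal_vec d lam b p $ i)\<^sup>2) \<le> 0"
    using assms(3) by (simp add: nodal_vec_scalar_prod[symmetric] scalar_prod_def power2_eq_square)
  then have "\<forall>i\<in>{0..<d}. (nodal_vec d lam b p $ i)\<^sup>2 = 0"
    by (subst sum_nonneg_eq_0_iff[symmetric]) (auto intro!: antisym sum_nonneg)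
  then have "nodal_vec d lam b p = 0\<^sub>v d" by (intro eq_vecI) auto
  then show ?thesis using assms by (auto simp: nodal_inj_def)
qed

text \<open>The old entries survive among the new ones; this carries the grade bound over to the
  extended problem.\<close>

lemma nodal_inj_extend:
  assumes "nodal_inj d lam b n" "d \<le> dt"
  shows "nodal_inj dt lam b n"
  unfolding nodal_inj_def
proof safe
  fix p assume p: "p \<in> polys_below n" "nodal_vec dt lam b p = 0\<^sub>v dt"
  have "nodal_vec d lam b p $ i = 0" if "i < d" for i
    using arg_cong[OF p(2), of "\<lambda>v. v $ i"] that assms(2) by (simp add: nodal_vec_def)
  then have "nodal_vec d lam b p = 0\<^sub>v d" by (intro eq_vecI) auto
  then show "p = 0" using assms p by (auto simp: nodal_inj_def)
qed

text \<open>Riesz representation by Gram-Schmidt: each degree adds one orthogonal direction, and the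
  representer for lower degrees is corrected along it.\<close>

lemma poly_inner_representer:
  assumes "nodal_inj d lam b n"
    and "\<And>p q. L (p + q) = L p + L q" and "\<And>a p. L (Polynomial.smult a p) = a * L p"
  shows "\<exists>g \<in> polys_below n. \<forall>q \<in> polys_below n. poly_inner d lam b g q = L q"
  using assms
proof (induction n arbitrary: L)
  case 0
  have "p = 0" if "p \<in> polys_below 0" for p using that by (auto simp: polys_below_def poly_eq_iff)
  moreover have "L 0 = 0" using "0.prems"(3)[of 0 0] by simp
  ultimately show ?case by (intro bexI[of _ 0]) (auto simp: polys_below_def)
next
  case (Suc n)
  let ?I = "poly_inner d lam b"
  have inj: "nodal_inj d lam b n" using Suc.prems(1) by (rule nodal_inj_mono) simp
  obtain g0 where g0: "g0 \<in> polys_below n" "\<forall>q\<in>polys_below n. ?I g0 q = L q"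
    using Suc.IH[OF inj, of L] Suc.prems by blast
  obtain g1 where g1: "g1 \<in> polys_below n" "\<forall>q\<in>polys_below n. ?I g1 q = ?I (monom 1 n) q"
    using Suc.IH[OF inj, of "?I (monom 1 n)"] by (metis poly_inner_add_left poly_inner_smult_left poly_inner_commute)
  \<comment> \<open>The monic polynomial of degree \<open>n\<close> orthogonal to all lower
    degrees.\<close>
  define h where "h = monom 1 n - g1"
  have h: "h \<in> polys_below (Suc n)" "coeff h n = 1"
    using g1(1) by (auto simp: h_def polys_below_def)
  have h_orth: "?I h q = 0" if "q \<in> polys_below n" for q
    using g1(2) that by (simp add: h_def poly_inner_left)
  have hh: "?I h h > 0"
  proof (rule ccontr)
    assume "\<not> ?I h h > 0"
    then have "h = 0" using nodal_injD[OF Suc.prems(1) h(1)] by simp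
    then show False using h(2) by simp
  qed
  define g where "g = g0 + Polynomial.smult (L h / ?I h h) h"
  have "?I g q = L q" if q: "q \<in> polys_below (Suc n)" for q
  proof -
    define r where "r = q - Polynomial.smult (coeff q n) h"
    have r: "r \<in> polys_below n"
      unfolding r_def by (rule polys_below_SucD) (use q h in \<open>auto intro: polys_below_diff polys_below_smult\<close>)
    have q_eq: "q = r + Polynomial.smult (coeff q n) h" by (simp add: r_def)
    have "?I g q = ?I g0 r + coeff q n * L h"
      using hh h_orth[OF r] h_orth[OF g0(1)]
      by (subst q_eq) (simp add: g_def poly_inner_left poly_inner_right poly_inner_commute[of _ _ _ g0 h] field_simps)
    also have "\<dots> = L q"
      using g0(2) r Suc.prems(2,3) by (subst (2) q_eq) simp
    finally show ?thesis .
  qed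
  moreover have "g \<in> polys_below (Suc n)"
    unfolding g_def using g0(1) h(1) by (intro polys_below_add polys_below_smult) (auto intro: polys_below_mono)
  ultimately show ?case by blast
qed

section \<open>Reproducing kernels and the norm-minimizing polynomials\<close>

definition reproduces ::
    "nat \<Rightarrow> (nat \<Rightarrow> real) \<Rightarrow> (nat \<Rightarrow> real) \<Rightarrow> nat \<Rightarrow> real \<Rightarrow> real poly \<Rightarrow> bool" where
  "reproduces d lam b n y k \<longleftrightarrow>
     k \<in> polys_below n \<and> (\<forall>q \<in> polys_below n. poly_inner d lam b k q = poly q y)"

lemma ex_reproduces: "nodal_inj d lam b n \<Longrightarrow> \<exists>k. reproduces d lam b n y k"
  using poly_inner_representer[of d lam b n "\<lambda>p. poly p y"] by (auto simp: reproduces_def)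

text \<open>Pythagoras splits the squared norm of a feasible \<open>p\<close> into those of
  \<open>h\<close> and \<open>p - h\<close>; definiteness then makes the minimizer unique.\<close>

lemma the_arg_min_poly_nrm:
  assumes "nodal_inj d lam b n" and "F h"
    and F: "\<And>p. F p \<Longrightarrow> p - h \<in> polys_below n \<and> poly_inner d lam b h (p - h) = 0"
  shows "(THE p. is_arg_min (\<lambda>p. (poly_nrm d lam b p)\<^sup>2) F p) = h"
proof (rule the_equality)
  let ?I = "poly_inner d lam b"
  have split: "?I p p = ?I h h + ?I (p - h) (p - h)" if "F p" for p
    using F[OF that] poly_inner_commute[of d lam b h p]
    by (simp add: poly_inner_left poly_inner_right)
  have "?I h h \<le> ?I p p" if "F p" for p
    using split[OF that] poly_inner_self_nonneg[of d lam b "p - h"] by linarith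
  then show "is_arg_min (\<lambda>p. (poly_nrm d lam b p)\<^sup>2) F h"
    using assms(2) by (simp add: is_arg_min_linorder poly_nrm_power2)
  fix p assume "is_arg_min (\<lambda>p. (poly_nrm d lam b p)\<^sup>2) F p"
  then have p: "F p" "?I p p \<le> ?I h h"
    using assms(2) by (auto simp: is_arg_min_linorder poly_nrm_power2)
  then have "p - h = 0"
    using F split[OF p(1)] by (intro nodal_injD[OF assms(1)]) auto
  then show "p = h" by simp
qed

text \<open>Competing monic polynomials differ by elements of \<open>polys_below n\<close>, so
  definiteness there is enough and \<open>n\<close> may equal the grade.\<close>

lemma pi_poly_props:
  assumes "nodal_inj d lam b n"
  shows "pi_poly d lam b n \<in> polys_below (Suc n)" and "coeff (pi_poly d lam b n) n = 1"
    and "\<And>q. q \<in> polys_below n \<Longrightarrow> poly_inner d lam b (pi_poly d lam b n) q = 0"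
proof -
  let ?I = "poly_inner d lam b"
  obtain g where g: "g \<in> polys_below n" "\<forall>q\<in>polys_below n. ?I g q = ?I (monom 1 n) q"
    using poly_inner_representer[OF assms, of "?I (monom 1 n)"]
    by (metis poly_inner_add_left poly_inner_smult_left poly_inner_commute)
  define h where "h = monom 1 n - g"
  have h: "h \<in> polys_below (Suc n)" "coeff h n = 1"
    using g(1) by (auto simp: h_def polys_below_def)
  have h_orth: "?I h q = 0" if "q \<in> polys_below n" for q
    using g(2) that by (simp add: h_def poly_inner_left)
  have "pi_poly d lam b n = h"
    unfolding pi_poly_def
  proof (rule the_arg_min_poly_nrm[OF assms])
    show "degree h \<le> n \<and> coeff h n = 1" using h by (simp add: degree_le_iff_polys_below)
    fix p :: "real poly" assume p: "degree p \<le> n \<and> coeff p n = 1"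
    have "p - h \<in> polys_below n"
      by (rule polys_below_SucD)
        (use p h in \<open>auto simp: degree_le_iff_polys_below intro: polys_below_diff\<close>)
    then show "p - h \<in> polys_below n \<and> ?I h (p - h) = 0" by (simp add: h_orth)
  qed
  then show "pi_poly d lam b n \<in> polys_below (Suc n)" "coeff (pi_poly d lam b n) n = 1"
    "\<And>q. q \<in> polys_below n \<Longrightarrow> ?I (pi_poly d lam b n) q = 0"
    using h h_orth by auto
qed

text \<open>A root at 0 would give \<open>pi = x q\<close>, and orthogonality to \<open>q\<close>
  would mean \<open><x q, q> = 0\<close>; with positive nodes \<open>q\<close> vanishes, against the
  leading coefficient 1.\<close>

lemma pi_poly_0_nonzero:
  assumes "nodal_inj d lam b n" and "\<And>i. i \<in> {1..d} \<Longrightarrow> lam i > 0"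
  shows "poly (pi_poly d lam b n) 0 \<noteq> 0"
proof
  let ?I = "poly_inner d lam b"
  note pi = pi_poly_props[OF assms(1)]
  assume "poly (pi_poly d lam b n) 0 = 0"
  then obtain q where q: "pi_poly d lam b n = pCons 0 q"
    by (cases "pi_poly d lam b n") auto
  then have q_in: "q \<in> polys_below n" using pi(1) by simp
  then have "(\<Sum>i = 1..d. lam i * (b i * poly q (lam i))\<^sup>2) = 0"
    using pi(3)[of q] by (simp add: q poly_inner_def power2_eq_square mult_ac)
  then have "\<forall>i\<in>{1..d}. lam i * (b i * poly q (lam i))\<^sup>2 = 0"
    by (subst sum_nonneg_eq_0_iff[symmetric]) (use assms(2) in \<open>force intro!: mult_nonneg_nonneg\<close>)+
  then have "\<forall>i\<in>{1..d}. b i * poly q (lam i) = 0" using assms(2) by force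
  then have "?I q q = 0"
    unfolding poly_inner_def by (intro sum.neutral) (auto simp: power2_eq_square)
  then have "q = 0" using nodal_injD[OF assms(1) q_in] by simp
  then show False using pi(2) q by simp
qed

text \<open>These are the conditions on a residual polynomial in \<open>cg_of_residual_poly\<close>,
  here for the unperturbed problem.\<close>

lemma varsigma_poly_props:
  assumes "nodal_inj d lam b n" and "\<And>i. i \<in> {1..d} \<Longrightarrow> lam i > 0"
  shows "varsigma_poly d lam b n \<in> polys_below (Suc n)" and "poly (varsigma_poly d lam b n) 0 = 1"
    and "\<And>q. q \<in> polys_below n \<Longrightarrow> poly_inner d lam b (varsigma_poly d lam b n) q = 0"
  using pi_poly_props[OF assms(1)] pi_poly_0_nonzero[OF assms]
  by (auto simp: varsigma_poly_def poly_inner_left intro: polys_below_smult)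

text \<open>\<open>k(y)\<close> is the squared norm of \<open>k\<close>, and \<open>k\<close> is
  nonzero because it reproduces the constant 1.\<close>

lemma reproduces_diag_pos:
  assumes "nodal_inj d lam b n" "1 \<le> n" "reproduces d lam b n y k"
  shows "poly k y > 0"
proof (rule ccontr)
  assume "\<not> poly k y > 0"
  then have "poly_inner d lam b k k \<le> 0" using assms by (simp add: reproduces_def)
  then have "k = 0" using nodal_injD assms by (auto simp: reproduces_def)
  moreover have "poly_inner d lam b k 1 = 1"
    using one_in_polys_below[OF assms(2)] assms(3) by (simp add: reproduces_def)
  ultimately show False by simp
qed

text \<open>Feasible polynomials differ by polynomials vanishing at \<open>lam j\<close>, and the
  kernel at that point is orthogonal to these.\<close>

lemma zeta_poly_eq:
  assumes "nodal_inj d lam b (Suc n)" "reproduces d lam b (Suc n) (lam j) k"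
  shows "zeta_poly d lam b j n = Polynomial.smult (1 / poly k (lam j)) k"
  unfolding zeta_poly_def
proof (rule the_arg_min_poly_nrm[OF assms(1)])
  let ?z = "Polynomial.smult (1 / poly k (lam j)) k"
  have pos: "poly k (lam j) > 0" using reproduces_diag_pos[OF assms(1) _ assms(2)] by simp
  have z: "?z \<in> polys_below (Suc n)" "poly ?z (lam j) = 1"
    using assms(2) pos by (auto simp: reproduces_def intro: polys_below_smult)
  then show "degree ?z \<le> n \<and> poly ?z (lam j) = 1" by (simp only: degree_le_iff_polys_below)
  fix p :: "real poly" assume p: "degree p \<le> n \<and> poly p (lam j) = 1"
  then have "p - ?z \<in> polys_below (Suc n)"
    using z(1) by (auto simp: degree_le_iff_polys_below intro!: polys_below_diff)
  then show "p - ?z \<in> polys_below (Suc n) \<and> poly_inner d lam b ?z (p - ?z) = 0"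
    using assms(2) p pos unfolding reproduces_def poly_inner_smult_left by simp
qed

text \<open>\<open>xi\<close> is the kernel scaled to the value 1 at 0, whence
  \<open>xi(lam j) = k(lam j) / k(0)\<close> and
  \<open><xi, xi> = k(lam j) / k(0)^2\<close>.\<close>

lemma xi_poly_reproduces:
  assumes "nodal_inj d lam b (Suc n)" "reproduces d lam b (Suc n) (lam j) k"
    and "poly_inner d lam b (xi_poly d lam b j n) (xi_poly d lam b j n) > 0"
  shows "poly k 0 = poly (xi_poly d lam b j n) (lam j)
           / poly_inner d lam b (xi_poly d lam b j n) (xi_poly d lam b j n)"
    and "poly k x = poly k 0 * poly (xi_poly d lam b j n) x"
proof -
  have pos: "poly k (lam j) > 0" using reproduces_diag_pos[OF assms(1) _ assms(2)] by simp
  have xi: "xi_poly d lam b j n = Polynomial.smult (1 / poly k 0) k"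
    using pos by (simp add: xi_poly_def zeta_poly_eq[OF assms(1,2)])
  \<comment> \<open>For \<open>k(0) = 0\<close> division by zero would make \<open>xi\<close> the
    zero polynomial, which its positive norm excludes.\<close>
  then have nz: "poly k 0 \<noteq> 0" using assms(3) by auto
  have "poly_inner d lam b k k = poly k (lam j)" using assms(2) by (simp add: reproduces_def)
  then show "poly k 0 = poly (xi_poly d lam b j n) (lam j)
           / poly_inner d lam b (xi_poly d lam b j n) (xi_poly d lam b j n)"
    using nz pos by (simp add: xi poly_inner_left poly_inner_right field_simps)
  show "poly k x = poly k 0 * poly (xi_poly d lam b j n) x" using nz by (simp add: xi)
qed


section \<open>Coercivity of the extended problem\<close>

lemma poly_inner_pCons_ge:
  assumes "\<And>i. i \<in> {1..d} \<Longrightarrow> L \<le> lam i"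
  shows "L * poly_inner d lam b p p \<le> poly_inner d lam b (pCons 0 p) p"
  unfolding poly_inner_def sum_distrib_left
proof (rule sum_mono)
  fix i assume "i \<in> {1..d}"
  then have "L * (b i * poly p (lam i))\<^sup>2 \<le> lam i * (b i * poly p (lam i))\<^sup>2"
    by (intro mult_right_mono assms) auto
  then show "L * ((b i)\<^sup>2 * poly p (lam i) * poly p (lam i))
      \<le> (b i)\<^sup>2 * poly (pCons 0 p) (lam i) * poly p (lam i)"
    by (simp add: power2_eq_square mult_ac)
qed

text \<open>The weights \<open>lam i\<close> are absorbed into \<open>b i\<close> through square
  roots, which reduces the claim to the plain inequality.\<close>

lemma poly_inner_pCons_Cauchy_Schwarz:
  assumes "\<And>i. i \<in> {1..d} \<Longrightarrow> 0 \<le> lam i"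
  shows "(poly_inner d lam b (pCons 0 p) q)\<^sup>2
      \<le> poly_inner d lam b (pCons 0 p) p * poly_inner d lam b (pCons 0 q) q"
proof -
  have "poly_inner d lam b (pCons 0 p) q = poly_inner d lam (\<lambda>i. b i * sqrt (lam i)) p q" for p q
    unfolding poly_inner_def using assms
    by (intro sum.cong) (auto simp: power_mult_distrib)
  then show ?thesis using poly_inner_Cauchy_Schwarz by simp
qed

text \<open>Cauchy-Schwarz in \<open><x p, q>\<close> bounds \<open>p(y)^2\<close> by
  \<open>k0(y) <x p, p>\<close>, with \<open>k0 = (k - k(0) s) / x\<close>. The factor
  \<open>\<mu> - y\<close> is then controlled by \<open>y k0(y) = k(y) - k(0) s(y)\<close> and
  \<open>L k0(y) \<le> k(y)\<close>.\<close>

lemma evaluation_bound: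
  assumes lam: "\<And>i. i \<in> {1..d} \<Longrightarrow> L \<le> lam i" and "0 < L"
    and s: "s \<in> polys_below (Suc n)" "poly s 0 = 1"
      "\<And>q. q \<in> polys_below n \<Longrightarrow> poly_inner d lam b s q = 0"
    and k: "reproduces d lam b n y k" and p: "p \<in> polys_below n" and "\<mu> \<le> L"
  shows "(\<mu> - y) * (poly p y)\<^sup>2 \<le> \<bar>poly k 0 * poly s y\<bar> * poly_inner d lam b (pCons 0 p) p"
proof -
  let ?I = "poly_inner d lam b"
  let ?D = "?I (pCons 0 p) p"
  have D: "0 \<le> ?D"
    using poly_inner_pCons_ge[of d L lam b p] lam poly_inner_self_nonneg[of d lam b p] \<open>0 < L\<close>
    by (meson mult_nonneg_nonneg less_imp_le order_trans)
  \<comment> \<open>\<open>k0\<close> represents the evaluation at \<open>y\<close> with respect to \<open>\<langle>xp, q\<rangle>\<close>, so \<open>poly k0 y\<close> is the optimal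
    constant in \<open>(p(y))\<^sup>2 \<le> C \<langle>xp, p\<rangle>\<close>.\<close>
  obtain k0 where k0: "k - Polynomial.smult (poly k 0) s = pCons 0 k0"
    using s(2) by (cases "k - Polynomial.smult (poly k 0) s") (metis diff_self mult.right_neutral
        mult_zero_left add.right_neutral poly_diff poly_pCons poly_smult)
  have "pCons 0 k0 \<in> polys_below (Suc n)"
    unfolding k0[symmetric] using k s
    by (intro polys_below_diff polys_below_smult) (auto simp: reproduces_def intro: polys_below_mono)
  then have k0_in: "k0 \<in> polys_below n" by simp
  have repr: "?I (pCons 0 k0) q = poly q y" if "q \<in> polys_below n" for q
    unfolding k0[symmetric] using k s(3) that by (simp add: poly_inner_left reproduces_def)
  have y: "y * poly k0 y = poly k y - poly k 0 * poly s y"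
    using arg_cong[OF k0, of "\<lambda>p. poly p y"] by simp
  have ge: "L * ?I k0 k0 \<le> poly k0 y"
    using poly_inner_pCons_ge[of d L lam b k0] lam repr[OF k0_in] by simp
  then have nonneg: "0 \<le> poly k0 y"
    using poly_inner_self_nonneg[of d lam b k0] \<open>0 < L\<close> by (meson mult_nonneg_nonneg less_imp_le order_trans)
  have ky: "?I k k = poly k y" using k by (simp add: reproduces_def)
  then have ky_nonneg: "0 \<le> poly k y" by (metis poly_inner_self_nonneg)
  \<comment> \<open>Since \<open>k\<close> reproduces \<open>k0\<close>, Cauchy-Schwarz for this
    pair and \<open>ge\<close> give \<open>L k0(y)^2 \<le> k(y) k0(y)\<close>, where
    \<open>k0(y)\<close> can be cancelled.\<close>
  have "(poly k0 y)\<^sup>2 \<le> poly k y * ?I k0 k0"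
    using poly_inner_Cauchy_Schwarz[of d lam b k k0] k k0_in ky by (simp add: reproduces_def)
  then have "L * (poly k0 y)\<^sup>2 \<le> poly k y * (L * ?I k0 k0)"
    using \<open>0 < L\<close> by (simp add: mult.left_commute)
  also have "\<dots> \<le> poly k y * poly k0 y" using ge ky_nonneg by (rule mult_left_mono)
  finally have "L * poly k0 y * poly k0 y \<le> poly k y * poly k0 y"
    by (simp add: power2_eq_square mult.assoc)
  then have Lk0: "L * poly k0 y \<le> poly k y"
    using nonneg ky_nonneg by (cases "poly k0 y = 0") auto
  have "\<mu> * poly k0 y \<le> L * poly k0 y" using \<open>\<mu> \<le> L\<close> nonneg by (rule mult_right_mono)
  with Lk0 y have bound: "(\<mu> - y) * poly k0 y \<le> poly k 0 * poly s y"
    by (simp add: left_diff_distrib)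
  show ?thesis
  proof (cases "y \<le> \<mu>")
    case True
    have "(poly p y)\<^sup>2 \<le> poly k0 y * ?D"
      using poly_inner_pCons_Cauchy_Schwarz[of d lam b k0 p] lam \<open>0 < L\<close> repr[OF p] repr[OF k0_in]
      by force
    then have "(\<mu> - y) * (poly p y)\<^sup>2 \<le> (\<mu> - y) * poly k0 y * ?D"
      using True by (simp add: mult_left_mono mult.assoc)
    also have "\<dots> \<le> \<bar>poly k 0 * poly s y\<bar> * ?D"
      using bound D by (intro mult_right_mono) auto
    finally show ?thesis .
  next
    case False
    then have "(\<mu> - y) * (poly p y)\<^sup>2 \<le> 0" by (simp add: mult_nonpos_nonneg)
    also have "0 \<le> \<bar>poly k 0 * poly s y\<bar> * ?D" using D by simp
    finally show ?thesis .
  qed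
qed

lemma poly_inner_extend:
  assumes "d \<le> dt"
  shows "poly_inner dt lam b p q
    = poly_inner d lam b p q + (\<Sum>j = d+1..dt. (b j)\<^sup>2 * poly p (lam j) * poly q (lam j))"
proof -
  have "{1..dt} = {1..d} \<union> {d+1..dt}" using assms by auto
  then show ?thesis unfolding poly_inner_def by (simp add: sum.union_disjoint)
qed

text \<open>Extra nodes below \<open>(1 - \<omega>) L\<close>, possibly negative, create a deficit.
  By \<open>evaluation_bound\<close> it costs at most \<open>\<omega> <x p, p>\<close> on the old
  nodes, and the remaining \<open>(1 - \<omega>) <x p, p>\<close> is at least
  \<open>(1 - \<omega>) L <p, p>\<close>.\<close>

lemma extended_coercive:
  assumes lam: "\<And>i. i \<in> {1..d} \<Longrightarrow> L \<le> lam i" and "0 < L"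
    and s: "s \<in> polys_below (Suc n)" "poly s 0 = 1"
      "\<And>q. q \<in> polys_below n \<Longrightarrow> poly_inner d lam b s q = 0"
    and k: "\<And>j. j \<in> {d+1..dt} \<Longrightarrow> reproduces d lam b n (lam j) (k j)"
    and small: "(\<Sum>j = d+1..dt. (b j)\<^sup>2 * \<bar>poly (k j) 0 * poly s (lam j)\<bar>) \<le> \<omega>"
    and "0 \<le> \<omega>" "\<omega> < 1" and "d \<le> dt" and p: "p \<in> polys_below n"
  shows "(1 - \<omega>) * L * poly_inner dt lam b p p \<le> poly_inner dt lam b (pCons 0 p) p"
proof -
  let ?I = "poly_inner d lam b" and ?\<mu> = "(1 - \<omega>) * L"
  let ?D = "?I (pCons 0 p) p"
  have "?\<mu> \<le> L" using \<open>0 < L\<close> \<open>0 \<le> \<omega>\<close> by (simp add: mult_left_le_one_le)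
  have ge: "L * ?I p p \<le> ?D" using poly_inner_pCons_ge[of d L lam b p] lam by blast
  then have D: "0 \<le> ?D"
    using poly_inner_self_nonneg[of d lam b p] \<open>0 < L\<close> by (meson mult_nonneg_nonneg less_imp_le order_trans)
  have "(\<Sum>j = d+1..dt. (b j)\<^sup>2 * ((?\<mu> - lam j) * (poly p (lam j))\<^sup>2))
      \<le> (\<Sum>j = d+1..dt. (b j)\<^sup>2 * (\<bar>poly (k j) 0 * poly s (lam j)\<bar> * ?D))"
    using evaluation_bound[OF lam \<open>0 < L\<close> s k p \<open>?\<mu> \<le> L\<close>]
    by (intro sum_mono mult_left_mono) auto
  also have "\<dots> = (\<Sum>j = d+1..dt. (b j)\<^sup>2 * \<bar>poly (k j) 0 * poly s (lam j)\<bar>) * ?D"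
    by (simp add: sum_distrib_right mult.assoc)
  also have "\<dots> \<le> \<omega> * ?D" using small D by (rule mult_right_mono)
  finally have "(\<Sum>j = d+1..dt. (b j)\<^sup>2 * ((?\<mu> - lam j) * (poly p (lam j))\<^sup>2)) \<le> \<omega> * ?D" .
  moreover have "(1 - \<omega>) * (L * ?I p p) \<le> (1 - \<omega>) * ?D"
    using ge \<open>\<omega> < 1\<close> by (intro mult_left_mono) auto
  moreover have "(\<Sum>j = d+1..dt. (b j)\<^sup>2 * ((?\<mu> - lam j) * (poly p (lam j))\<^sup>2))
      = ?\<mu> * (\<Sum>j = d+1..dt. (b j)\<^sup>2 * poly p (lam j) * poly p (lam j))
        - (\<Sum>j = d+1..dt. (b j)\<^sup>2 * poly (pCons 0 p) (lam j) * poly p (lam j))"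
    unfolding sum_distrib_left sum_subtractf[symmetric]
    by (intro sum.cong) (auto simp: power2_eq_square algebra_simps)
  ultimately show ?thesis
    by (simp add: poly_inner_extend[OF \<open>d \<le> dt\<close>] algebra_simps)
qed

text \<open>With \<open>r = 1 - x p\<close>, orthogonality of \<open>r\<close> says that the
  gradient of the energy at \<open>p(A) b\<close> is orthogonal to the Krylov space; coercivity
  makes this point the unique minimizer.\<close>

lemma cg_of_residual_poly:
  assumes inj: "nodal_inj d lam b n" and "0 < \<mu>"
    and coercive: "\<And>p. p \<in> polys_below n \<Longrightarrow>
        \<mu> * poly_inner d lam b p p \<le> poly_inner d lam b (pCons 0 p) p"
    and r: "r \<in> polys_below (Suc n)" "poly r 0 = 1"
      "\<And>q. q \<in> polys_below n \<Longrightarrow> poly_inner d lam b r q = 0"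
  shows "cg_well_defined (A_mat d lam) (b_vec d b) n"
    and "vec_nrm (cg_iterate (A_mat d lam) (b_vec d b) n) \<le> vec_nrm (b_vec d b) / \<mu>"
    and "(vec_nrm (cg_residual (A_mat d lam) (b_vec d b) n))\<^sup>2 = poly_inner d lam b r r"
proof -
  let ?A = "A_mat d lam" and ?b = "b_vec d b" and ?I = "poly_inner d lam b"
  let ?N = "nodal_vec d lam b"
  have pos: "0 < ?I (pCons 0 p) p" if "p \<in> polys_below n" "p \<noteq> 0" for p
  proof -
    have "0 < ?I p p" using nodal_injD[OF inj that(1)] that(2) by force
    with coercive[OF that(1)] \<open>0 < \<mu>\<close> show ?thesis by (metis less_le_trans mult_pos_pos)
  qed
  have N0: "?N 0 = 0\<^sub>v d" by (auto simp: nodal_vec_def intro!: eq_vecI)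
  show "cg_well_defined ?A ?b n"
    unfolding cg_well_defined_def krylov_eq le_grade_iff
    using inj pos N0
    by (auto simp: A_mat_mult_nodal_vec nodal_vec_scalar_prod b_vec_dim poly_inner_commute[of d lam b _ "pCons 0 _"])
  obtain p where p: "1 - r = pCons 0 p"
    using r(2) by (cases "1 - r") (metis diff_self mult_zero_left add.right_neutral poly_1 poly_diff poly_pCons)
  have "pCons 0 p \<in> polys_below (Suc n)"
    unfolding p[symmetric] using r(1) by (intro polys_below_diff one_in_polys_below) auto
  then have p_in: "p \<in> polys_below n" by simp
  have repr: "?I (pCons 0 p) q = ?I 1 q" if "q \<in> polys_below n" for q
    unfolding p[symmetric] using r(3)[OF that] by (simp add: poly_inner_left)
  define J where "J v = 1/2 * (v \<bullet> (?A *\<^sub>v v)) - ?b \<bullet> v" for v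
  have J: "J (?N q) = 1/2 * ?I (pCons 0 q) q - ?I 1 q" for q
    by (simp add: J_def A_mat_mult_nodal_vec b_vec_eq_nodal_vec[of d b lam] nodal_vec_scalar_prod
        poly_inner_commute[of d lam b q])
  \<comment> \<open>Completing the square: the linear term cancels by \<open>repr\<close>.\<close>
  have split: "J (?N q) = J (?N p) + 1/2 * ?I (pCons 0 (q - p)) (q - p)"
    if "q \<in> polys_below n" for q
  proof -
    have "?I (pCons 0 q) p = ?I (pCons 0 p) q"
      by (metis poly_inner_pCons poly_inner_commute)
    moreover have eq: "pCons 0 (q - p) = pCons 0 q - pCons 0 p" by simp
    have "?I (pCons 0 (q - p)) (q - p)
        = ?I (pCons 0 q) q - ?I (pCons 0 q) p - (?I (pCons 0 p) q - ?I (pCons 0 p) p)"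
      unfolding eq poly_inner_diff_left poly_inner_right(2) by simp
    ultimately show ?thesis
      using repr[OF that] repr[OF p_in] unfolding J by linarith
  qed
  have iterate: "cg_iterate ?A ?b n = ?N p"
    unfolding cg_iterate_def J_def[symmetric] krylov_eq
  proof (rule the_equality)
    have "J (?N p) \<le> J (?N q)" if "q \<in> polys_below n" for q
    proof (cases "q = p")
      case False
      then show ?thesis using split[OF that] pos[OF polys_below_diff[OF that p_in]] by auto
    qed simp
    then show "is_arg_min J (\<lambda>v. v \<in> ?N ` polys_below n) (?N p)"
      using p_in by (auto simp: is_arg_min_linorder)
    fix v assume "is_arg_min J (\<lambda>v. v \<in> ?N ` polys_below n) v"
    then obtain q where q: "v = ?N q" "q \<in> polys_below n" "J (?N q) \<le> J (?N p)"
      using p_in by (auto simp: is_arg_min_linorder)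
    show "v = ?N p"
    proof (cases "q = p")
      case False
      then have "0 < ?I (pCons 0 (q - p)) (q - p)"
        using q p_in by (intro pos polys_below_diff) auto
      then show ?thesis using split[OF q(2)] q(3) by simp
    qed (simp add: q)
  qed
  have nrm: "(vec_nrm (?N q))\<^sup>2 = ?I q q" for q
    by (simp add: vec_nrm_def nodal_vec_scalar_prod poly_inner_self_nonneg)
  have residual: "cg_residual ?A ?b n = ?N r"
  proof -
    have "r = 1 - pCons 0 p" using p by (metis diff_diff_eq2 add_diff_cancel_left')
    then show ?thesis
      unfolding cg_residual_def iterate unfolding A_mat_mult_nodal_vec b_vec_eq_nodal_vec[of d b lam]
      by (intro eq_vecI) (auto simp: nodal_vec_def right_diff_distrib)
  qed
  then show "(vec_nrm (cg_residual ?A ?b n))\<^sup>2 = ?I r r" by (simp add: nrm)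
  let ?v = "vec_nrm (?N p)"
  have v: "0 \<le> ?v" "0 \<le> vec_nrm ?b"
    by (simp_all add: vec_nrm_def nodal_vec_scalar_prod b_vec_eq_nodal_vec[of d b lam] poly_inner_self_nonneg)
  \<comment> \<open>The iterate \<open>v\<close> satisfies
    \<open>\<mu> |v|^2 \<le> <x p, p> = <1, p> \<le> |b| |v|\<close>.\<close>
  have "(?I 1 p)\<^sup>2 \<le> (vec_nrm ?b * ?v)\<^sup>2"
    using poly_inner_Cauchy_Schwarz[of d lam b 1 p]
    by (simp add: power_mult_distrib nrm b_vec_eq_nodal_vec[of d b lam])
  then have "?I 1 p \<le> vec_nrm ?b * ?v" using v by (metis power2_le_imp_le mult_nonneg_nonneg)
  moreover have "\<mu> * ?v\<^sup>2 \<le> ?I 1 p" using coercive[OF p_in] repr[OF p_in] nrm by simp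
  ultimately have "\<mu> * ?v * ?v \<le> vec_nrm ?b * ?v" by (simp add: power2_eq_square)
  then have "\<mu> * ?v \<le> vec_nrm ?b" using v by (cases "?v = 0") auto
  then show "vec_nrm (cg_iterate ?A ?b n) \<le> vec_nrm ?b / \<mu>"
    using \<open>0 < \<mu>\<close> by (simp add: iterate field_simps)
qed

section \<open>The perturbed residual polynomial\<close>

lemma frob_nrm_B_mat:
  assumes "d \<le> dt"
  shows "(frob_nrm (B_mat d dt b))\<^sup>2 = (\<Sum>j = d+1..dt. (b j)\<^sup>2)"
proof -
  have "(frob_nrm (B_mat d dt b))\<^sup>2
      = (\<Sum>i<dt - d. \<Sum>j<dt - d. (if i = j then b (Suc (d + j)) else 0)\<^sup>2)"
    by (simp add: frob_nrm_def B_mat_def mat_diag_def sum_nonneg)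
  also have "\<dots> = (\<Sum>i<dt - d. \<Sum>j<dt - d. if i = j then (b (Suc (d + j)))\<^sup>2 else 0)"
    by (intro sum.cong) auto
  also have "\<dots> = (\<Sum>i<dt - d. (b (Suc (d + i)))\<^sup>2)" by simp
  also have "\<dots> = (\<Sum>j = d+1..dt. (b j)\<^sup>2)"
    by (rule sum.reindex_bij_witness[of _ "\<lambda>j. j - d - 1" "\<lambda>i. d + i + 1"]) auto
  finally show ?thesis .
qed

text \<open>\<open>g\<close> is the projection of \<open>s\<close> onto \<open>polys_below n\<close>
  in the extended inner product. As \<open>s\<close> is already orthogonal on the first
  \<open>d\<close> nodes, \<open><g, q>\<close> reduces to a sum over the extra nodes, so
  \<open>g\<close> must be a combination of their kernels.\<close>

lemma perturbed_residual_poly: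
  assumes inj: "nodal_inj d lam b n" and "d \<le> dt"
    and s: "s \<in> polys_below (Suc n)"
      "\<And>q. q \<in> polys_below n \<Longrightarrow> poly_inner d lam b s q = 0"
    and k: "\<And>j. j \<in> {d+1..dt} \<Longrightarrow> reproduces d lam b n (lam j) (k j)"
  obtains g where "g \<in> polys_below n"
    and "\<And>q. q \<in> polys_below n \<Longrightarrow> poly_inner dt lam b (s - g) q = 0"
    and "g = (\<Sum>j = d+1..dt. Polynomial.smult ((b j)\<^sup>2 * poly (s - g) (lam j)) (k j))"
    and "poly_inner d lam b g g = (\<Sum>j = d+1..dt. (b j)\<^sup>2 * poly (s - g) (lam j) * poly g (lam j))"
proof -
  let ?I = "poly_inner d lam b" and ?It = "poly_inner dt lam b"
  have "nodal_inj dt lam b n" using nodal_inj_extend[OF inj \<open>d \<le> dt\<close>] .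
  then obtain g where g: "g \<in> polys_below n" "\<forall>q\<in>polys_below n. ?It g q = ?It s q"
    using poly_inner_representer[of dt lam b n "?It s"] by (auto simp: poly_inner_right)
  have orth: "?It (s - g) q = 0" if "q \<in> polys_below n" for q
    using g(2) that by (simp add: poly_inner_left)
  have I_g: "?I g q = (\<Sum>j = d+1..dt. (b j)\<^sup>2 * poly (s - g) (lam j) * poly q (lam j))"
    if "q \<in> polys_below n" for q
    using orth[OF that] s(2)[OF that] unfolding poly_inner_extend[OF \<open>d \<le> dt\<close>]
    by (simp add: poly_inner_diff_left)
  let ?h = "\<Sum>j = d+1..dt. Polynomial.smult ((b j)\<^sup>2 * poly (s - g) (lam j)) (k j)"
  have "?I ?h q = ?I g q" if q: "q \<in> polys_below n" for q
    unfolding I_g[OF q] poly_inner_sum_left poly_inner_smult_left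
    using k q by (intro sum.cong) (auto simp: reproduces_def)
  moreover have in_P: "g - ?h \<in> polys_below n"
    using g(1) k by (intro polys_below_diff polys_below_sum polys_below_smult) (auto simp: reproduces_def)
  ultimately have "?I (g - ?h) (g - ?h) \<le> 0" by (simp add: poly_inner_diff_left)
  then have "g - ?h = 0" by (rule nodal_injD[OF inj in_P])
  then have "g = ?h" by simp
  with g(1) orth I_g[OF g(1)] show ?thesis using that by blast
qed


text \<open>In the application \<open>J\<close> holds the extra nodes, \<open>w\<close> the squares
  of the \<open>b j\<close>, \<open>\<rho>\<close> and \<open>s\<close> the values of the perturbed
  and unperturbed residual polynomials, \<open>K\<close> and \<open>\<kappa>\<close> the kernel
  values at the nodes and at 0, and \<open>D = 1 + \<delta>\<close>.\<close>

lemma perturbation_estimates: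
  fixes w \<rho> s g \<kappa> :: "'a \<Rightarrow> real" and K :: "'a \<Rightarrow> 'a \<Rightarrow> real"
  assumes w: "\<And>j. j \<in> J \<Longrightarrow> 0 \<le> w j"
    and s: "\<And>j. j \<in> J \<Longrightarrow> s j = \<rho> j + g j" "\<And>j. j \<in> J \<Longrightarrow> \<bar>s j - 1\<bar> \<le> \<tau>"
    and g: "\<And>i. i \<in> J \<Longrightarrow> g i = (\<Sum>j\<in>J. w j * \<rho> j * K j i)"
    and Q: "0 \<le> (\<Sum>j\<in>J. w j * \<rho> j * g j)"
    and K: "\<And>j. j \<in> J \<Longrightarrow> \<bar>\<kappa> j\<bar> \<le> a" "\<And>i j. i \<in> J \<Longrightarrow> j \<in> J \<Longrightarrow> \<bar>K j i\<bar> \<le> a * D"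
    and nonneg: "0 \<le> a" "0 \<le> D" "0 \<le> \<tau>"
    and \<eta>: "\<eta> = \<tau> + (1 + \<tau>) * D * a * sum w J" and \<omega>: "\<omega> = (1 + \<eta>) * a * sum w J"
  shows "(\<Sum>j\<in>J. w j * (\<rho> j)\<^sup>2) \<le> (1 + \<tau>)\<^sup>2 * sum w J"
    and "\<bar>\<Sum>j\<in>J. w j * \<rho> j * \<kappa> j\<bar> \<le> \<omega>"
    and "(\<Sum>j\<in>J. w j * \<rho> j * g j) \<le> (1 + \<eta>) * D * \<omega> * sum w J"
proof -
  let ?\<beta> = "sum w J" and ?T = "\<Sum>j\<in>J. w j * \<bar>\<rho> j\<bar>"
  have \<beta>: "0 \<le> ?\<beta>" using w by (rule sum_nonneg)
  have s_le: "\<bar>s j\<bar> \<le> 1 + \<tau>" if "j \<in> J" for j using s(2)[OF that] by linarith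
  \<comment> \<open>By \<open>Q\<close> the cross term of \<open>s = \<rho> + g\<close> is
    nonnegative, so \<open>\<rho>\<close> is no larger than \<open>s\<close> in the weighted
    quadratic norm.\<close>
  have "(\<Sum>j\<in>J. w j * (\<rho> j)\<^sup>2) + 2 * (\<Sum>j\<in>J. w j * \<rho> j * g j) + (\<Sum>j\<in>J. w j * (g j)\<^sup>2)
      = (\<Sum>j\<in>J. w j * (s j)\<^sup>2)"
    unfolding sum_distrib_left sum.distrib[symmetric]
    by (intro sum.cong) (auto simp: s(1) power2_eq_square algebra_simps)
  moreover have "0 \<le> (\<Sum>j\<in>J. w j * (g j)\<^sup>2)" using w by (intro sum_nonneg) auto
  moreover have "(\<Sum>j\<in>J. w j * (s j)\<^sup>2) \<le> (\<Sum>j\<in>J. w j * (1 + \<tau>)\<^sup>2)"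
    using w s_le nonneg(3) by (intro sum_mono mult_left_mono) (auto simp: abs_le_square_iff[symmetric])
  ultimately show sq: "(\<Sum>j\<in>J. w j * (\<rho> j)\<^sup>2) \<le> (1 + \<tau>)\<^sup>2 * ?\<beta>"
    using Q by (simp add: sum_distrib_right[symmetric] mult.commute[of "sum w J"])
  have T0: "0 \<le> ?T" using w by (intro sum_nonneg) auto
  have T: "?T \<le> (1 + \<tau>) * ?\<beta>"
  proof (rule power2_le_imp_le)
    have "?T = (\<Sum>j\<in>J. \<bar>sqrt (w j)\<bar> * \<bar>sqrt (w j) * \<rho> j\<bar>)"
      using w by (intro sum.cong) (auto simp: abs_mult)
    also have "\<dots> \<le> L2_set (\<lambda>j. sqrt (w j)) J * L2_set (\<lambda>j. sqrt (w j) * \<rho> j) J"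
      by (rule L2_set_mult_ineq)
    finally have "?T\<^sup>2 \<le> (L2_set (\<lambda>j. sqrt (w j)) J * L2_set (\<lambda>j. sqrt (w j) * \<rho> j) J)\<^sup>2"
      using T0 by (rule power_mono)
    also have "\<dots> = ?\<beta> * (\<Sum>j\<in>J. w j * (\<rho> j)\<^sup>2)"
      using w by (simp add: L2_set_def power_mult_distrib sum_nonneg)
    also have "\<dots> \<le> ?\<beta> * ((1 + \<tau>)\<^sup>2 * ?\<beta>)" using sq \<beta> by (rule mult_left_mono)
    finally show "?T\<^sup>2 \<le> ((1 + \<tau>) * ?\<beta>)\<^sup>2" by (simp add: power2_eq_square mult_ac)
    show "0 \<le> (1 + \<tau>) * ?\<beta>" using \<beta> nonneg by simp
  qed
  have g_le: "\<bar>g i\<bar> \<le> ?T * (a * D)" if "i \<in> J" for i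
  proof -
    have "\<bar>g i\<bar> \<le> (\<Sum>j\<in>J. \<bar>w j * \<rho> j * K j i\<bar>)" unfolding g[OF that] by (rule sum_abs)
    also have "\<dots> \<le> (\<Sum>j\<in>J. w j * \<bar>\<rho> j\<bar> * (a * D))"
      using w K(2) that by (intro sum_mono) (auto simp: abs_mult intro!: mult_left_mono)
    finally show ?thesis by (simp add: sum_distrib_right)
  qed
  have \<rho>_le: "\<bar>\<rho> j\<bar> \<le> 1 + \<eta>" if "j \<in> J" for j
  proof -
    \<comment> \<open>The resulting bound on \<open>g\<close> is exactly the second summand of
      \<open>\<eta>\<close>.\<close>
    have "?T * (a * D) \<le> (1 + \<tau>) * ?\<beta> * (a * D)" using T nonneg by (intro mult_right_mono) auto
    then have "\<bar>g j\<bar> \<le> \<eta> - \<tau>" using g_le[OF that] by (simp add: \<eta> mult_ac)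
    then show ?thesis using s(1)[OF that] s_le[OF that] by linarith
  qed
  \<comment> \<open>Summing the pointwise bound puts \<open>?T\<close> in the form in which
    \<open>\<omega>\<close> is defined.\<close>
  have "?T \<le> (\<Sum>j\<in>J. w j * (1 + \<eta>))" using w \<rho>_le by (intro sum_mono mult_left_mono) auto
  then have T_\<eta>: "?T \<le> (1 + \<eta>) * ?\<beta>" by (simp add: sum_distrib_left mult.commute)
  then have T\<omega>: "?T * a \<le> \<omega>" using mult_right_mono[OF T_\<eta> nonneg(1)] by (simp add: \<omega> mult_ac)
  have "\<bar>\<Sum>j\<in>J. w j * \<rho> j * \<kappa> j\<bar> \<le> (\<Sum>j\<in>J. \<bar>w j * \<rho> j * \<kappa> j\<bar>)" by (rule sum_abs)
  also have "\<dots> \<le> (\<Sum>j\<in>J. w j * \<bar>\<rho> j\<bar> * a)"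
    using w K(1) by (intro sum_mono) (auto simp: abs_mult intro!: mult_left_mono)
  finally show "\<bar>\<Sum>j\<in>J. w j * \<rho> j * \<kappa> j\<bar> \<le> \<omega>" using T\<omega> by (simp add: sum_distrib_right)
  have \<omega>D: "0 \<le> \<omega> * D"
    using T\<omega> T0 nonneg by (meson mult_nonneg_nonneg order_trans)
  have "w j * \<rho> j * g j \<le> w j * ((1 + \<eta>) * (\<omega> * D))" if "j \<in> J" for j
  proof -
    have "?T * a * D \<le> \<omega> * D" using T\<omega> nonneg(2) by (rule mult_right_mono)
    then have "\<bar>g j\<bar> \<le> \<omega> * D" using g_le[OF that] by (simp add: mult.assoc)
    then have "\<bar>\<rho> j\<bar> * \<bar>g j\<bar> \<le> (1 + \<eta>) * (\<omega> * D)"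
      using \<rho>_le[OF that] by (intro mult_mono') auto
    then have "\<rho> j * g j \<le> (1 + \<eta>) * (\<omega> * D)"
      by (metis abs_ge_self abs_mult order_trans)
    then show ?thesis using w[OF that] by (simp add: mult.assoc mult_left_mono)
  qed
  then have "(\<Sum>j\<in>J. w j * \<rho> j * g j) \<le> (\<Sum>j\<in>J. w j * ((1 + \<eta>) * (\<omega> * D)))" by (rule sum_mono)
  also have "\<dots> = (1 + \<eta>) * D * \<omega> * ?\<beta>"
    unfolding sum_distrib_right[symmetric] by (simp add: mult_ac)
  finally show "(\<Sum>j\<in>J. w j * \<rho> j * g j) \<le> (1 + \<eta>) * D * \<omega> * ?\<beta>" .
qed

section \<open>Assembly of the estimates at the iteration \<open>m\<close>\<close>

theorem lemma3p14:
  fixes d dt m :: nat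
    and lam b :: "nat \<Rightarrow> real"
    and c \<delta> \<tau> \<eta> \<omega> normB :: real
  assumes "1 \<le> d" and "d \<le> dt"
    and "\<And>i j. 1 \<le> i \<Longrightarrow> i \<le> j \<Longrightarrow> j \<le> dt \<Longrightarrow> lam j \<le> lam i"
    and "lam d > 0"
    and "d < dt \<Longrightarrow> lam d > lam (d + 1)"
    and "0 < c" and "c \<le> inverse (lam d) * (vec_nrm (b_vec d b))\<^sup>2"
    and "admissible_iteration d dt lam b c m"
    and "\<delta> = delta d dt lam b m"
    and "\<tau> = tau d dt lam b m"
    and "\<eta> = eta d dt lam b c m"
    and "\<omega> = omega d dt lam b c m"
    and "normB = frob_nrm (B_mat d dt b)"
    and "\<omega> < 1"
  shows "\<exists>n \<in> {1..grade (A_mat d lam) (b_vec d b)}.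
           cg_well_defined (A_mat dt lam) (b_vec dt b) n \<and>
           vec_nrm (cg_iterate (A_mat dt lam) (b_vec dt b) n)
             \<le> 1 / ((1 - \<omega>) * lam d) * vec_nrm (b_vec dt b) \<and>
           (vec_nrm (cg_residual (A_mat dt lam) (b_vec dt b) n))\<^sup>2
             \<le> 1 / (1 - \<omega>)\<^sup>2
               * (lam 1 * c + (1 + \<eta>) * (1 + \<delta>) * \<omega> * normB\<^sup>2 + (1 + \<tau>)\<^sup>2 * normB\<^sup>2)"
proof -
  let ?J = "{d+1..dt}" and ?I = "poly_inner d lam b" and ?It = "poly_inner dt lam b"
  let ?s = "varsigma_poly d lam b m" and ?xi = "\<lambda>j. xi_poly d lam b j (m - 1)"
  let ?\<beta> = "\<Sum>j\<in>?J. (b j)\<^sup>2" and ?C = "lam d * c"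
  \<comment> \<open>\<open>a\<close> will bound every \<open>|k_j(0)|\<close>, and
    \<open>a * (1 + \<delta>)\<close> every kernel value at an extra node.\<close>
  define a where "a = (1 + \<delta>) * inverse ?C"
  have C: "0 < ?C" using assms by simp
  have adm: "1 \<le> m" "m \<le> grade (A_mat d lam) (b_vec d b)" "?I ?s ?s \<le> lam 1 * c"
    "\<And>j. j \<in> ?J \<Longrightarrow> ?C \<le> ?I (?xi j) (?xi j)"
    using \<open>admissible_iteration d dt lam b c m\<close>
    by (auto simp: admissible_iteration_def poly_nrm_power2)
  have inj: "nodal_inj d lam b m" using adm(2) by (simp add: le_grade_iff)
  have lam: "lam d \<le> lam i" if "i \<in> {1..d}" for i using assms(2,3) that by simp
  then have lam_pos: "0 < lam i" if "i \<in> {1..d}" for i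
    using that \<open>lam d > 0\<close> by (meson less_le_trans)
  have s: "?s \<in> polys_below (Suc m)" "poly ?s 0 = 1" "\<And>q. q \<in> polys_below m \<Longrightarrow> ?I ?s q = 0"
    using varsigma_poly_props[OF inj] lam_pos by blast+
  obtain k where k: "\<And>j. reproduces d lam b m (lam j) (k j)"
    using choice[of "\<lambda>j. reproduces d lam b m (lam j)"] ex_reproduces[OF inj] by blast

  \<comment> \<open>The 0 inserted into the maximum gives nonnegativity, also when there are no
    extra nodes.\<close>
  have \<delta>: "0 \<le> \<delta>" "\<And>i j. i \<in> ?J \<Longrightarrow> j \<in> ?J \<Longrightarrow> \<bar>poly (?xi j) (lam i) - 1\<bar> \<le> \<delta>"
    unfolding \<open>\<delta> = delta d dt lam b m\<close> delta_def by (rule Max_ge; force)+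
  have \<tau>: "0 \<le> \<tau>" "\<And>i. i \<in> ?J \<Longrightarrow> \<bar>poly ?s (lam i) - 1\<bar> \<le> \<tau>"
    unfolding \<open>\<tau> = tau d dt lam b m\<close> tau_def by (rule Max_ge; force)+
  have a: "0 \<le> a" using C \<delta>(1) by (simp add: a_def del: inverse_mult_distrib)
  have \<beta>: "normB\<^sup>2 = ?\<beta>" "0 \<le> ?\<beta>"
    using frob_nrm_B_mat[OF \<open>d \<le> dt\<close>] assms(13) by (simp_all add: sum_nonneg)
  \<comment> \<open>One factor \<open>1 + \<delta>\<close> goes into \<open>a\<close>; the other one
    plays the part of \<open>D\<close> in \<open>perturbation_estimates\<close>.\<close>
  have \<eta>: "\<eta> = \<tau> + (1 + \<tau>) * (1 + \<delta>) * a * ?\<beta>"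
    unfolding assms(11) eta_def assms(9,10)[symmetric] assms(13)[symmetric] \<beta>(1) a_def
    by (simp add: power2_eq_square mult_ac)
  have \<omega>: "\<omega> = (1 + \<eta>) * a * ?\<beta>"
    unfolding assms(12) omega_def assms(9-11)[symmetric] assms(13)[symmetric] \<beta>(1) a_def
    by (simp add: mult_ac)

  have xi_le: "\<bar>poly (?xi j) (lam i)\<bar> \<le> 1 + \<delta>" if "i \<in> ?J" "j \<in> ?J" for i j
    using \<delta>(2)[OF that] by linarith
  have k0: "\<bar>poly (k j) 0\<bar> \<le> a" and ki: "i \<in> ?J \<Longrightarrow> \<bar>poly (k j) (lam i)\<bar> \<le> a * (1 + \<delta>)"
    if j: "j \<in> ?J" for i j
  proof -
    \<comment> \<open>\<open>xi\<close> of index \<open>m - 1\<close> has degree at most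
      \<open>m - 1\<close>, which is the space \<open>polys_below m\<close> of the kernels.\<close>
    have "nodal_inj d lam b (Suc (m - 1))" "reproduces d lam b (Suc (m - 1)) (lam j) (k j)"
      using inj k adm(1) by simp_all
    note xi = xi_poly_reproduces[OF this less_le_trans[OF C adm(4)[OF j]]]
    have "\<bar>poly (k j) 0\<bar> = \<bar>poly (?xi j) (lam j)\<bar> / ?I (?xi j) (?xi j)"
      by (subst xi(1)) (simp add: poly_inner_self_nonneg)
    also have "\<dots> \<le> (1 + \<delta>) / ?C"
      using xi_le[OF j j] adm(4)[OF j] C \<delta>(1) by (intro frac_le) auto
    finally show *: "\<bar>poly (k j) 0\<bar> \<le> a" by (simp add: a_def divide_inverse)
    show "\<bar>poly (k j) (lam i)\<bar> \<le> a * (1 + \<delta>)" if "i \<in> ?J"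
      by (subst xi(2)) (use * a xi_le[OF that j] in \<open>auto simp: abs_mult intro!: mult_mono\<close>)
  qed

  obtain g where g: "g \<in> polys_below m"
    "\<And>q. q \<in> polys_below m \<Longrightarrow> ?It (?s - g) q = 0"
    and g_eq: "g = (\<Sum>j\<in>?J. Polynomial.smult ((b j)\<^sup>2 * poly (?s - g) (lam j)) (k j))"
    and g_nrm: "?I g g = (\<Sum>j\<in>?J. (b j)\<^sup>2 * poly (?s - g) (lam j) * poly g (lam j))"
    using perturbed_residual_poly[OF inj \<open>d \<le> dt\<close> s(1,3) k] by blast
  let ?r = "?s - g"
  have poly_g: "poly g x = (\<Sum>j\<in>?J. (b j)\<^sup>2 * poly ?r (lam j) * poly (k j) x)" for x
    using arg_cong[OF g_eq, of "\<lambda>p. poly p x"] by (simp add: poly_sum)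
  have est:
    "(\<Sum>j\<in>?J. (b j)\<^sup>2 * (poly ?r (lam j))\<^sup>2) \<le> (1 + \<tau>)\<^sup>2 * ?\<beta>"
    "\<bar>\<Sum>j\<in>?J. (b j)\<^sup>2 * poly ?r (lam j) * poly (k j) 0\<bar> \<le> \<omega>"
    "(\<Sum>j\<in>?J. (b j)\<^sup>2 * poly ?r (lam j) * poly g (lam j)) \<le> (1 + \<eta>) * (1 + \<delta>) * \<omega> * ?\<beta>"
  proof -
    have w: "0 \<le> (b j)\<^sup>2" if "j \<in> ?J" for j by simp
    have split: "poly ?s (lam j) = poly ?r (lam j) + poly g (lam j)" if "j \<in> ?J" for j by simp
    have g_i: "poly g (lam i) = (\<Sum>j\<in>?J. (b j)\<^sup>2 * poly ?r (lam j) * poly (k j) (lam i))"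
      if "i \<in> ?J" for i by (rule poly_g)
    \<comment> \<open>The sum is the squared norm of \<open>g\<close>.\<close>
    have Q: "0 \<le> (\<Sum>j\<in>?J. (b j)\<^sup>2 * poly ?r (lam j) * poly g (lam j))"
      by (metis g_nrm poly_inner_self_nonneg)
    have D: "0 \<le> 1 + \<delta>" using \<delta>(1) by simp
    note estimates = perturbation_estimates[of ?J "\<lambda>j. (b j)\<^sup>2" "\<lambda>j. poly ?s (lam j)"
        "\<lambda>j. poly ?r (lam j)" "\<lambda>j. poly g (lam j)" \<tau> "\<lambda>j i. poly (k j) (lam i)" "\<lambda>j. poly (k j) 0",
        OF w split \<tau>(2) g_i Q k0 ki a D \<tau>(1) \<eta> \<omega>]
    show "(\<Sum>j\<in>?J. (b j)\<^sup>2 * (poly ?r (lam j))\<^sup>2) \<le> (1 + \<tau>)\<^sup>2 * ?\<beta>"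
      by (rule estimates(1))
    show "\<bar>\<Sum>j\<in>?J. (b j)\<^sup>2 * poly ?r (lam j) * poly (k j) 0\<bar> \<le> \<omega>"
      by (rule estimates(2))
    show "(\<Sum>j\<in>?J. (b j)\<^sup>2 * poly ?r (lam j) * poly g (lam j)) \<le> (1 + \<eta>) * (1 + \<delta>) * \<omega> * ?\<beta>"
      by (rule estimates(3))
  qed
  \<comment> \<open>The value at 0 is \<open>1 - g(0)\<close>, and
    \<open>|g(0)| \<le> \<omega>\<close>.\<close>
  have r0: "1 - \<omega> \<le> poly ?r 0" using est(2) s(2) poly_g[of 0] by simp
  then have r0_pos: "0 < poly ?r 0" using \<open>\<omega> < 1\<close> by linarith
  have r_nrm: "?It ?r ?r \<le> lam 1 * c + (1 + \<eta>) * (1 + \<delta>) * \<omega> * normB\<^sup>2 + (1 + \<tau>)\<^sup>2 * normB\<^sup>2"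
  proof -
    \<comment> \<open>Pythagoras on the first \<open>d\<close> nodes; the three terms of the claimed
      bound come from \<open>s\<close>, from \<open>g\<close> and from the extra nodes.\<close>
    have "?I ?r ?r = ?I ?s ?s + ?I g g"
      using s(3)[OF g(1)] poly_inner_commute[of d lam b g ?s]
      by (simp add: poly_inner_left poly_inner_right)
    then have "?It ?r ?r = ?I ?s ?s + ?I g g + (\<Sum>j\<in>?J. (b j)\<^sup>2 * (poly ?r (lam j))\<^sup>2)"
      by (simp add: poly_inner_extend[OF \<open>d \<le> dt\<close>] power2_eq_square mult.assoc)
    then show ?thesis using est(1,3) adm(3) unfolding g_nrm \<beta>(1) by linarith
  qed

  have "0 \<le> \<eta>" using \<eta> \<tau>(1) \<delta>(1) a \<beta>(2) by simp
  then have "0 \<le> \<omega>" using \<omega> a \<beta>(2) by simp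
  have "(\<Sum>j\<in>?J. (b j)\<^sup>2 * \<bar>poly (k j) 0 * poly ?s (lam j)\<bar>) \<le> (\<Sum>j\<in>?J. (b j)\<^sup>2 * (a * (1 + \<eta>)))"
  proof (intro sum_mono mult_left_mono)
    fix j assume j: "j \<in> ?J"
    \<comment> \<open>Relaxing \<open>1 + \<tau>\<close> to \<open>1 + \<eta>\<close> makes the sum
      equal to \<open>\<omega>\<close>, the constant that also bounds \<open>|g(0)|\<close>.\<close>
    have "\<tau> \<le> \<eta>" using \<eta> \<tau>(1) \<delta>(1) a \<beta>(2) by simp
    then have "\<bar>poly ?s (lam j)\<bar> \<le> 1 + \<eta>" using \<tau>(2)[OF j] by linarith
    then show "\<bar>poly (k j) 0 * poly ?s (lam j)\<bar> \<le> a * (1 + \<eta>)"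
      using k0[OF j] a by (auto simp: abs_mult intro!: mult_mono)
  qed simp
  also have "\<dots> = \<omega>"
    unfolding sum_distrib_right[symmetric] by (simp add: \<omega> mult_ac)
  finally have small: "(\<Sum>j\<in>?J. (b j)\<^sup>2 * \<bar>poly (k j) 0 * poly ?s (lam j)\<bar>) \<le> \<omega>" .

  \<comment> \<open>Normalizing to the value 1 at 0 produces the factor
    \<open>1 / (1 - \<omega>)^2\<close> in the residual bound.\<close>
  let ?rn = "Polynomial.smult (1 / poly ?r 0) ?r"
  have "?rn \<in> polys_below (Suc m)"
    using s(1) g(1) by (intro polys_below_smult polys_below_diff) (auto intro: polys_below_mono)
  moreover have "poly ?rn 0 = 1" using r0_pos by simp
  moreover have "?It ?rn q = 0" if "q \<in> polys_below m" for q
    using g(2)[OF that] by (simp add: poly_inner_smult_left)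
  moreover have "0 < (1 - \<omega>) * lam d" using \<open>\<omega> < 1\<close> \<open>lam d > 0\<close> by simp
  moreover note extended_coercive[OF lam \<open>lam d > 0\<close> s k small \<open>0 \<le> \<omega>\<close> \<open>\<omega> < 1\<close> \<open>d \<le> dt\<close>]
  ultimately have cg: "cg_well_defined (A_mat dt lam) (b_vec dt b) m"
    "vec_nrm (cg_iterate (A_mat dt lam) (b_vec dt b) m) \<le> vec_nrm (b_vec dt b) / ((1 - \<omega>) * lam d)"
    "(vec_nrm (cg_residual (A_mat dt lam) (b_vec dt b) m))\<^sup>2 = ?It ?rn ?rn"
    using cg_of_residual_poly[OF nodal_inj_extend[OF inj \<open>d \<le> dt\<close>], of "(1 - \<omega>) * lam d" ?rn]
    by blast+
  have "?It ?rn ?rn = 1 / (poly ?r 0)\<^sup>2 * ?It ?r ?r"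
    by (simp only: poly_inner_smult_self power_one_over)
  also have "\<dots> \<le> 1 / (1 - \<omega>)\<^sup>2 * ?It ?r ?r"
    using r0 \<open>\<omega> < 1\<close> by (intro mult_right_mono divide_left_mono power_mono) (auto simp: poly_inner_self_nonneg)
  also have "\<dots> \<le> 1 / (1 - \<omega>)\<^sup>2
      * (lam 1 * c + (1 + \<eta>) * (1 + \<delta>) * \<omega> * normB\<^sup>2 + (1 + \<tau>)\<^sup>2 * normB\<^sup>2)"
    using r_nrm by (rule mult_left_mono) simp
  finally show ?thesis using cg adm(1,2) by (intro bexI[of _ m]) auto
qed

end
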